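(* Let $c<0$ be a real number, let $l\ge 1$ be an integer, and let $n=-cl$. For $t\in\left[0,-\frac1c\right]$ put $T:=t+ct^2$, $\rho:=\sqrt{n^2+c^2}$ and $R:=\sqrt{16\rho^2T^2+8cT+1}$. Then for all $t\in\left[0,-\frac1c\right]$, $$S_{n,c}(t)^2 \le \frac{2}{1+4cT+R}\left(\frac{1}{R+4nT}\right)^{n/c}\left(\frac{\rho R+4\rho^2T+c}{\rho+c}\right)^{\rho/c}.$$
   Context: For real $a$ and integer $k\ge 1$, $\binom{a}{k}:=\frac{a(a-1)\cdots(a-k+1)}{k!}$, and $\binom{a}{0}:=1$. For $c<0$, $n=-cl$ with $l\ge1$ an integer, integers $k\ge 0$ and $x\in[0,-\frac1c]$, define $$p_{n,k}^{[c]}(x):=\binom{-n/c}{k}(-cx)^k(1+cx)^{-\frac{n}{c}-k},$$ where $-n/c=l$, so that $p_{n,k}^{[c]}(x)=\binom{l}{k}(-cx)^k(1+cx)^{l-k}$ for $0\le k\le l$ (with $0^0=1$) and $p_{n,k}^{[c]}(x)=0$ for $k>l$. For each $x$ the sequence $(p_{n,k}^{[c]}(x))_{k\ge 0}$ is a probability distribution. Its index of coincidence is $$S_{n,c}(x):=\sum_{k=0}^\infty \left(p_{n,k}^{[c]}(x)\right)^2,\qquad x\in\left[0,-\tfrac1c\right].$$ *)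

theory Defs
  imports Complex_Main
begin

(* Real power with the convention 0^0 = 1; Isabelle has 0 powr 0 = 0. It is needed at
   x = -1/c, k = l, where the last factor of the distribution below is 0^0. *)
definition rpow :: "real \<Rightarrow> real \<Rightarrow> real" where
  "rpow a b = (if a = 0 \<and> b = 0 then 1 else a powr b)"

(* In the case c < 0, n = -c l, the values with k > l vanish because (l gchoose k) = 0. *)
definition p :: "real \<Rightarrow> real \<Rightarrow> nat \<Rightarrow> real \<Rightarrow> real" where
  "p c n k x = ((- n / c) gchoose k) * (- c * x) ^ k * rpow (1 + c * x) (- n / c - real k)"

definition S :: "real \<Rightarrow> real \<Rightarrow> real \<Rightarrow> real" where
  "S n c x = (\<Sum>k. (p c n k x)\<^sup>2)"

lemma p_eq:
  assumes "c < 0" "n = - c * real l" "x \<in> {0..- 1 / c}"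
  shows "p c n k x = (if k \<le> l then real (l choose k) * (- c * x) ^ k * (1 + c * x) ^ (l - k) else 0)"
proof -
  have l: "- n / c = real l" using assms by simp
  have nn: "0 \<le> 1 + c * x" using assms by (auto simp: field_simps)
  have r: "rpow (1 + c * x) (real l - real k) = (1 + c * x) ^ (l - k)" if "k \<le> l"
    using that nn
    by (cases "1 + c * x = 0"; cases "k = l")
       (simp_all add: rpow_def powr_realpow flip: of_nat_diff)
  show ?thesis
    unfolding p_def l using r by (simp flip: binomial_gbinomial)
qed

lemma S_eq:
  assumes "c < 0" "n = - c * real l" "x \<in> {0..- 1 / c}"
  shows "S n c x = (\<Sum>k\<le>l. (real (l choose k) * (- c * x) ^ k * (1 + c * x) ^ (l - k))\<^sup>2)"
  unfolding S_def by (subst suminf_finite[where N = "{..l}"]) (simp_all add: p_eq[OF assms])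

end

theory Submission
  imports Defs
begin

text \<open>
  Put \<open>w = \<bar>1 + 2 * c * t\<bar>\<close>, so that \<open>1 + 4 * c * T = w\<^sup>2\<close> and \<open>S n c t = f w\<close> for a polynomial \<open>f\<close>
  that solves a second order linear ODE. The logarithmic derivative \<open>G = f' / f\<close> satisfies the
  Riccati equation
  \<open>w * (1 - w\<^sup>2) * (G' + G\<^sup>2) = (2 * l - (2 * l - 2) * w\<^sup>2) * G - 2 * l * w\<close>. Differentiating it
  gives a first order linear inequality for \<open>G'\<close>, from which \<open>G' \<ge> 0\<close> on \<open>(0, 1)\<close> follows: \<open>f\<close> is
  log-convex. Dropping \<open>G'\<close> from the Riccati equation therefore leaves a quadratic inequality for
  \<open>G\<close>, so \<open>G\<close> is at least the smaller root of the quadratic. That root is half the logarithmic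
  derivative of the right-hand side of the theorem, and both sides equal 1 at \<open>w = 1\<close>.
\<close>

section \<open>Moments of the squared binomial weights\<close>

text \<open>At \<open>w = 1 + 2 * c * t\<close> the two bases are \<open>- c * t\<close> and
  \<open>1 + c * t\<close>, so \<open>sqmom l 0 w\<close> is the index of coincidence. The moments
  with \<open>j > 0\<close> arise when it is differentiated.\<close>

definition sqmom :: "nat \<Rightarrow> nat \<Rightarrow> real \<Rightarrow> real" where
  "sqmom l j w = (\<Sum>k\<le>l. real k ^ j * (real (l choose k))\<^sup>2 * ((1 - w) / 2) ^ (2 * k) * ((1 + w) / 2) ^ (2 * (l - k)))"

text \<open>The logarithmic derivative of the k-th weight is \<open>- k / A + (l - k) / B = (2 * l *
  (1 - w) - 4 * k) / (1 - w^2)\<close>. It is affine in k, and the factor k raises the moment by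
  one.\<close>

lemma DERIV_sqmom:
  assumes "-1 < w" "w < 1"
  shows "(sqmom l j has_real_derivative
           (2 * real l * (1 - w) * sqmom l j w - 4 * sqmom l (Suc j) w) / (1 - w\<^sup>2)) (at w)"
proof -
  define A B where "A = (1 - w) / 2" and "B = (1 + w) / 2"
  have AB: "A > 0" "B > 0" "A + B = 1" "1 - w\<^sup>2 = 4 * A * B"
    using assms by (auto simp: A_def B_def field_simps power2_eq_square)
  \<comment> \<open>The quotient form also covers \<open>m = 0\<close>, where the truncated exponent
    \<open>m - 1\<close> is 0 but the factor \<open>m\<close> vanishes.\<close>
  have pw: "real m * x ^ (m - 1) = real m * x ^ m / x" if "x > 0" for m and x :: real
    using that by (cases m) auto
  have *: "((\<lambda>w. real k ^ j * (real (l choose k))\<^sup>2 * ((1 - w) / 2) ^ (2 * k) * ((1 + w) / 2) ^ (2 * (l - k)))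
     has_real_derivative (2 * real l * (1 - w) * (real k ^ j * (real (l choose k))\<^sup>2 * A ^ (2 * k) * B ^ (2 * (l - k)))
        - 4 * (real k ^ Suc j * (real (l choose k))\<^sup>2 * A ^ (2 * k) * B ^ (2 * (l - k)))) / (1 - w\<^sup>2)) (at w)"
    if "k \<le> l" for k
  proof -
    have dA: "((\<lambda>w. ((1 - w) / 2) ^ (2 * k)) has_real_derivative - (real k * A ^ (2 * k) / A)) (at w)"
      using pw[OF AB(1), of "2 * k"]
      by (auto intro!: derivative_eq_intros simp: A_def[symmetric])
    have dB: "((\<lambda>w. ((1 + w) / 2) ^ (2 * (l - k))) has_real_derivative (real (l - k) * B ^ (2 * (l - k)) / B)) (at w)"
      using pw[OF AB(2), of "2 * (l - k)"]
      by (auto intro!: derivative_eq_intros simp: B_def[symmetric])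
    have lk: "real (l - k) = real l - real k" using that by (rule of_nat_diff)
    have e: "- (real k / A) + (real l - real k) / B = (2 * real l * (1 - w) - 4 * real k) / (1 - w\<^sup>2)"
      unfolding AB(4) using AB(1-2) by (simp add: field_simps) (simp add: A_def B_def field_simps)
    have "((\<lambda>w. real k ^ j * (real (l choose k))\<^sup>2 * ((1 - w) / 2) ^ (2 * k) * ((1 + w) / 2) ^ (2 * (l - k)))
       has_real_derivative real k ^ j * (real (l choose k))\<^sup>2 * (A ^ (2 * k) * B ^ (2 * (l - k))) * (- (real k / A) + (real l - real k) / B)) (at w)"
      using DERIV_mult[OF DERIV_cmult[OF dA, of "real k ^ j * (real (l choose k))\<^sup>2"] dB]
      by (simp add: A_def[symmetric] B_def[symmetric] lk algebra_simps)
    then show ?thesis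
      unfolding e
      by (rule back_subst[where P = "\<lambda>D. (_ has_real_derivative D) _"]) (simp add: algebra_simps)
  qed
  have "(sqmom l j has_real_derivative (\<Sum>k\<le>l. (2 * real l * (1 - w) * (real k ^ j * (real (l choose k))\<^sup>2 * A ^ (2 * k) * B ^ (2 * (l - k)))
        - 4 * (real k ^ Suc j * (real (l choose k))\<^sup>2 * A ^ (2 * k) * B ^ (2 * (l - k)))) / (1 - w\<^sup>2))) (at w)"
    unfolding sqmom_def[abs_def] by (rule DERIV_sum) (use * in auto)
  then show ?thesis
    unfolding sqmom_def A_def[symmetric] B_def[symmetric]
      sum_divide_distrib[symmetric] sum_subtractf sum_distrib_left[symmetric] .
qed

text \<open>This is the hypergeometric equation of \<open>\<Sum>k. (l choose k)\<^sup>2 s ^ k\<close> at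
  \<open>s = ((1 - w) / (1 + w))\<^sup>2\<close>.\<close>
lemma sqmom_2:
  "w * sqmom l 2 w = ((1 - w) / 2)\<^sup>2 * ((real l)\<^sup>2 * sqmom l 0 w - 2 * real l * sqmom l 1 w)"
proof -
  define A B where "A = (1 - w) / 2" and "B = (1 + w) / 2"
  have w: "w = B\<^sup>2 - A\<^sup>2" by (simp add: A_def B_def field_simps power2_eq_square)
  have "B\<^sup>2 * sqmom l 2 w = (\<Sum>k\<le>l. (real k * real (l choose k))\<^sup>2 * A ^ (2 * k) * B ^ (2 * (l - k) + 2))"
    unfolding sqmom_def A_def[symmetric] B_def[symmetric] sum_distrib_left
    by (intro sum.cong refl) (simp only: power_add power_mult_distrib mult_ac)
  \<comment> \<open>Index shift: \<open>k * (l choose k) = l * (l - 1 choose k - 1)\<close> and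
    \<open>(l - k) * (l choose k) = l * (l - 1 choose k)\<close>. The terms at k = 0 on the left and
    at k = l on the right vanish.\<close>
  also have "\<dots> = (\<Sum>k\<le>l. (real (l - k) * real (l choose k))\<^sup>2 * A ^ (2 * k + 2) * B ^ (2 * (l - k)))"
  proof (cases l)
    case (Suc m)
    have 1: "real (Suc k) * real (Suc m choose Suc k) = real (Suc m) * real (m choose k)" for k
      by (metis Suc_times_binomial_eq of_nat_mult mult.commute)
    have 2: "real (Suc m - k) * real (Suc m choose k) = real (Suc m) * real (m choose k)" if "k \<le> m" for k
      using binomial_absorb_comp[of "Suc m" k] by (metis diff_Suc_1 of_nat_mult)
    have "(\<Sum>k\<le>l. (real k * real (l choose k))\<^sup>2 * A ^ (2 * k) * B ^ (2 * (l - k) + 2))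
        = (\<Sum>k\<le>m. (real (Suc m) * real (m choose k))\<^sup>2 * A ^ (2 * k + 2) * B ^ (2 * (m - k) + 2))"
      unfolding Suc sum.atMost_Suc_shift 1 by (simp del: of_nat_Suc)
    also have "\<dots> = (\<Sum>k\<le>m. (real (Suc m - k) * real (Suc m choose k))\<^sup>2 * A ^ (2 * k + 2) * B ^ (2 * (Suc m - k)))"
      by (intro sum.cong refl) (simp only: 2 atMost_iff, simp add: Suc_diff_le)
    finally show ?thesis unfolding Suc by simp
  qed simp
  \<comment> \<open>Expanding \<open>(l - k)^2\<close> reproduces the second moment with factor
    \<open>A^2\<close>. Moved to the left-hand side, it turns \<open>B^2\<close> into
    \<open>B^2 - A^2 = w\<close>.\<close>
  also have "\<dots> = (\<Sum>k\<le>l. A\<^sup>2 * ((real l)\<^sup>2 * (real k ^ 0 * (real (l choose k))\<^sup>2 * A ^ (2 * k) * B ^ (2 * (l - k)))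
       - 2 * real l * (real k ^ 1 * (real (l choose k))\<^sup>2 * A ^ (2 * k) * B ^ (2 * (l - k)))
       + real k ^ 2 * (real (l choose k))\<^sup>2 * A ^ (2 * k) * B ^ (2 * (l - k))))"
    by (intro sum.cong refl) (simp add: of_nat_diff power2_eq_square algebra_simps power_add)
  also have "\<dots> = A\<^sup>2 * ((real l)\<^sup>2 * sqmom l 0 w - 2 * real l * sqmom l 1 w + sqmom l 2 w)"
    unfolding sqmom_def A_def[symmetric] B_def[symmetric]
    by (simp only: sum_distrib_left[symmetric] sum.distrib sum_subtractf)
  finally show ?thesis
    unfolding A_def[symmetric] by (subst (1) w) (simp add: algebra_simps)
qed

text \<open>The reflection of k to \<open>l - k\<close> exchanges the two bases. Evenness reduces
  the theorem to \<open>w \<ge> 0\<close>, since the bound depends on \<open>w\<close> only through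
  \<open>w^2\<close>.\<close>

lemma sqmom_0_uminus: "sqmom l 0 (- w) = sqmom l 0 w"
  unfolding sqmom_def
  by (rule sum.reindex_bij_witness[where i = "\<lambda>k. l - k" and j = "\<lambda>k. l - k"])
     (auto simp: binomial_symmetric[symmetric])

lemma sqmom_nonneg: "-1 \<le> w \<Longrightarrow> w \<le> 1 \<Longrightarrow> 0 \<le> sqmom l j w"
  unfolding sqmom_def by (intro sum_nonneg mult_nonneg_nonneg) auto

lemma sqmom_0_pos:
  assumes "-1 < w" "w \<le> 1"
  shows "0 < sqmom l 0 w"
  unfolding sqmom_def
  by (rule sum_pos2[where i = 0]) (use assms in \<open>auto intro!: mult_nonneg_nonneg\<close>)

lemma sqmom_0_1 [simp]: "sqmom l 0 1 = 1"
  by (cases l) (simp_all add: sqmom_def sum.atMost_Suc_shift del: sum.atMost_Suc)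

lemma sqmom_1_1 [simp]: "sqmom l (Suc 0) 1 = 0"
  by (cases l) (simp_all add: sqmom_def sum.atMost_Suc_shift del: sum.atMost_Suc)

lemma continuous_on_sqmom [continuous_intros]: "continuous_on X (sqmom l j)"
  unfolding sqmom_def[abs_def] by (intro continuous_intros) auto

section \<open>The logarithmic derivative: Riccati equation and sign\<close>

text \<open>\<open>ln_slope l w\<close> is \<open>(1 - w\<^sup>2) * G w\<close> with \<open>G\<close> the logarithmic derivative of \<open>sqmom l 0\<close>; the
  factor makes it continuous up to \<open>w = 1\<close>.\<close>

definition ln_slope :: "nat \<Rightarrow> real \<Rightarrow> real" where
  "ln_slope l w = 2 * real l * (1 - w) - 4 * sqmom l 1 w / sqmom l 0 w"

lemma DERIV_sqmom_0:
  assumes "0 < w" "w < 1"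
  shows "(sqmom l 0 has_real_derivative sqmom l 0 w * ln_slope l w / (1 - w\<^sup>2)) (at w)"
proof -
  have "sqmom l 0 w * ln_slope l w = 2 * real l * (1 - w) * sqmom l 0 w - 4 * sqmom l 1 w"
    using sqmom_0_pos[of w l] assms by (simp add: ln_slope_def field_simps)
  then show ?thesis using DERIV_sqmom[of w l 0] assms by simp
qed

text \<open>This is the Riccati equation. The quotient rule leaves the moments of order 0, 1 and 2,
  and \<open>sqmom_2\<close> eliminates the second.\<close>

lemma DERIV_ln_slope:
  assumes "0 < w" "w < 1"
  shows "(ln_slope l has_real_derivative 2 * real l * ln_slope l w / w - 2 * real l - (ln_slope l w)\<^sup>2 / (1 - w\<^sup>2)) (at w)"
proof -
  define F0 F1 F2 where F: "F0 = sqmom l 0 w" "F1 = sqmom l 1 w" "F2 = sqmom l 2 w"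
  have F0: "F0 > 0" using sqmom_0_pos[of w l] assms by (simp add: F)
  define m where "m = F1 / F0"
  have F1: "F1 = m * F0" using F0 by (simp add: m_def)
  have F2: "F2 = ((1 - w) / 2)\<^sup>2 * ((real l)\<^sup>2 - 2 * real l * m) / w * F0"
    using sqmom_2[of w l] assms(1) unfolding F[symmetric] F1 by (simp add: field_simps)
  have d0: "(sqmom l 0 has_real_derivative (2 * real l * (1 - w) * F0 - 4 * F1) / (1 - w\<^sup>2)) (at w)"
    using DERIV_sqmom[of w l 0] assms by (simp add: F)
  have d1: "(sqmom l 1 has_real_derivative (2 * real l * (1 - w) * F1 - 4 * F2) / (1 - w\<^sup>2)) (at w)"
    using DERIV_sqmom[of w l 1] assms by (simp add: F numeral_2_eq_2)
  have v: "1 - w\<^sup>2 = (1 - w) * (1 + w)" by (simp add: algebra_simps power2_eq_square)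
  have K: "ln_slope l w = 2 * real l * (1 - w) - 4 * m" by (simp add: ln_slope_def F m_def)
  have "(ln_slope l has_real_derivative - 2 * real l - (4 * ((2 * real l * (1 - w) * F1 - 4 * F2) / (1 - w\<^sup>2)) * F0
           - 4 * F1 * ((2 * real l * (1 - w) * F0 - 4 * F1) / (1 - w\<^sup>2))) / (F0 * F0)) (at w)"
    unfolding ln_slope_def[abs_def]
    by (rule derivative_eq_intros d0 d1 refl)+ (use F0 in \<open>auto simp: F\<close>)
  moreover have "- 2 * real l - (4 * ((2 * real l * (1 - w) * F1 - 4 * F2) / (1 - w\<^sup>2)) * F0
           - 4 * F1 * ((2 * real l * (1 - w) * F0 - 4 * F1) / (1 - w\<^sup>2))) / (F0 * F0)
     = 2 * real l * ln_slope l w / w - 2 * real l - (ln_slope l w)\<^sup>2 / (1 - w\<^sup>2)"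
  proof -
    define q where "q = F2 / F0"
    have F2': "F2 = q * F0" using F0 by (simp add: q_def)
    have q: "q = ((1 - w) / 2)\<^sup>2 * ((real l)\<^sup>2 - 2 * real l * m) / w"
      using F0 by (simp add: q_def F2)
    \<comment> \<open>With the weights normalised, \<open>m\<close> is the mean and \<open>q\<close>
      the second moment of k, so the derivative of the mean is governed by the variance
      \<open>q - m^2\<close>.\<close>
    have "(4 * ((2 * real l * (1 - w) * F1 - 4 * F2) / (1 - w\<^sup>2)) * F0
           - 4 * F1 * ((2 * real l * (1 - w) * F0 - 4 * F1) / (1 - w\<^sup>2))) / (F0 * F0) = 16 * (m\<^sup>2 - q) / (1 - w\<^sup>2)"
    proof -
      have "(4 * ((2 * L * (1 - w) * (m * F0) - 4 * (q * F0)) / D) * F0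
           - 4 * (m * F0) * ((2 * L * (1 - w) * F0 - 4 * (m * F0)) / D)) / (F0 * F0) = 16 * (m\<^sup>2 - q) / D"
        if "D \<noteq> 0" for L D
        using that F0 by (simp add: divide_simps) (simp add: power2_eq_square algebra_simps)
      moreover have "1 - w\<^sup>2 \<noteq> 0" using assms by (simp add: v)
      ultimately show ?thesis unfolding F1 F2' by blast
    qed
    also have "\<dots> = (ln_slope l w)\<^sup>2 / (1 - w\<^sup>2) - 2 * real l * ln_slope l w / w"
      unfolding K q v using assms by (simp add: divide_simps) algebra
    finally show ?thesis by argo
  qed
  ultimately show ?thesis by (simp only:)
qed

lemma continuous_on_ln_slope: "0 < a \<Longrightarrow> continuous_on {a..1} (ln_slope l)"
  unfolding ln_slope_def[abs_def] by (intro continuous_intros ballI less_imp_neq[symmetric] sqmom_0_pos) auto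

lemma ln_slope_1 [simp]: "ln_slope l 1 = 0"
  by (simp add: ln_slope_def)

text \<open>The first moment is nonnegative, and \<open>2 * w * (1 - w)\<close> falls short of
  \<open>1 - w^2\<close> by the square \<open>(1 - w)^2\<close>. The bound controls the sign of the
  derivative in \<open>ln_curv_nonneg\<close>.\<close>

lemma ln_slope_le:
  assumes "0 < w" "w < 1"
  shows "w * ln_slope l w \<le> real l * (1 - w\<^sup>2)"
proof -
  have "ln_slope l w \<le> 2 * real l * (1 - w)"
    using sqmom_nonneg[of w l 1] sqmom_0_pos[of w l] assms by (simp add: ln_slope_def)
  then have "w * ln_slope l w \<le> w * (2 * real l * (1 - w))" using assms by simp
  also have "\<dots> = real l * (1 - w\<^sup>2) - real l * (1 - w)\<^sup>2" by (simp add: power2_eq_square algebra_simps)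
  finally show ?thesis by (smt (verit) zero_le_mult_iff of_nat_0_le_iff zero_le_power2)
qed

text \<open>In this form the power of \<open>w\<close> in an integrating factor visibly cancels a
  term \<open>n * h x / x\<close> of a linear equation.\<close>

lemma DERIV_divide_power:
  fixes x :: real
  assumes "(h has_real_derivative h') (at x)" "0 < x"
  shows "((\<lambda>w. h w / w ^ n) has_real_derivative (h' - real n * h x / x) / x ^ n) (at x)"
proof -
  have "real n * x ^ (n - 1) = real n * x ^ n / x"
    using assms(2) by (cases n) auto
  then have "((\<lambda>w. w ^ n) has_real_derivative real n * x ^ n / x) (at x)"
    using DERIV_pow[of n x] by simp
  from DERIV_divide[OF assms(1) this]
  have "((\<lambda>w. h w / w ^ n) has_real_derivative
      (h' * x ^ n - h x * (real n * x ^ n / x)) / (x ^ n * x ^ n)) (at x)"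
    using assms(2) by simp
  moreover have "(h' * y - h x * (real n * y / x)) / (y * y) = (h' - real n * h x / x) / y"
    if "y > 0" for y
    using that assms(2) by (simp add: field_simps)
  ultimately show ?thesis using assms(2) by simp
qed

text \<open>\<open>?M\<close> has derivative \<open>- 2 * l * sqmom l 0 x / x ^ (2 * l)\<close>,
  which is nonpositive, and it vanishes at 1.\<close>

lemma ln_slope_nonneg:
  assumes "0 < w" "w < 1"
  shows "0 \<le> ln_slope l w"
proof -
  \<comment> \<open>\<open>(1 - w\<^sup>2) / w ^ (2 * l)\<close> is the integrating factor of the ODE for \<open>f\<close>\<close>
  let ?M = "\<lambda>w. sqmom l 0 w * ln_slope l w / w ^ (2 * l)"
  have "?M w \<ge> ?M 1"
  proof (rule DERIV_nonpos_imp_decreasing_open[where f = ?M])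
    show "continuous_on {w..1} ?M"
      using assms by (intro continuous_intros continuous_on_ln_slope) auto
    fix x assume x: "w < x" "x < 1"
    then have x0: "0 < x" using assms by simp
    have v: "1 - x\<^sup>2 > 0" using x x0 by (simp add: power_less_one_iff abs_square_less_1)
    have "(?M has_real_derivative - 2 * real l * sqmom l 0 x / x ^ (2 * l)) (at x)"
    proof -
      \<comment> \<open>The quadratic term of the Riccati equation cancels against the derivative of
        \<open>sqmom l 0\<close>, and its \<open>1 / x\<close> term against the power of
        \<open>x\<close>.\<close>
      have *: "f * k / V * k + (2 * L * k / x - 2 * L - k\<^sup>2 / V) * f - 2 * L * (f * k) / x = - 2 * L * f"
        if "V > 0" for f k V L :: real
        using that x0 by (simp add: field_simps power2_eq_square)
      show ?thesis
        using DERIV_divide_power[OF DERIV_mult[OF DERIV_sqmom_0[OF x0 x(2)] DERIV_ln_slope[OF x0 x(2)]] x0, of l l "2 * l"]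
          *[OF v, of "sqmom l 0 x" "ln_slope l x" "real l"]
        by simp
    qed
    moreover have "- 2 * real l * sqmom l 0 x / x ^ (2 * l) \<le> 0"
      using sqmom_0_pos[of x l] x x0 by simp
    ultimately show "\<exists>y. (?M has_real_derivative y) (at x) \<and> y \<le> 0" by blast
  qed (use assms in auto)
  then show ?thesis
    using assms sqmom_0_pos[of w l] zero_less_power[of w "2 * l"]
    by (auto simp: zero_le_divide_iff zero_le_mult_iff not_le[symmetric] simp del: zero_less_power)
qed

section \<open>Log-convexity\<close>

text \<open>\<open>ln_curv l w\<close> is \<open>(1 - w\<^sup>2)\<^sup>2 * G' w\<close>, expressed through the Riccati equation.\<close>

definition ln_curv :: "nat \<Rightarrow> real \<Rightarrow> real" where
  "ln_curv l w = 2 * real l * (1 - w\<^sup>2) * ln_slope l w / w + 2 * w * ln_slope l w - 2 * real l * (1 - w\<^sup>2) - (ln_slope l w)\<^sup>2"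

text \<open>The weighted curvature \<open>?M\<close> is nonincreasing and vanishes at 1. Its
  derivative reduces to a negative multiple of \<open>B\<close>, which is nonnegative by
  \<open>ln_slope_nonneg\<close> and \<open>ln_slope_le\<close>.\<close>

lemma ln_curv_nonneg:
  assumes "0 < w" "w < 1" "l \<ge> 1"
  shows "0 \<le> ln_curv l w"
proof -
  \<comment> \<open>the integrating factor of the linear equation for \<open>G'\<close>\<close>
  let ?M = "\<lambda>w. (sqmom l 0 w)\<^sup>2 * ln_curv l w / w ^ (2 * l)"
  have "?M w \<ge> ?M 1"
  proof (rule DERIV_nonpos_imp_decreasing_open[where f = ?M])
    show "continuous_on {w..1} ?M"
      using assms unfolding ln_curv_def by (intro continuous_intros continuous_on_ln_slope) auto
    fix x assume x: "w < x" "x < 1"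
    then have x0: "0 < x" using assms by simp
    have v: "1 - x\<^sup>2 > 0" using x x0 by (simp add: abs_square_less_1)
    define k where "k = ln_slope l x"
    define L where "L = real l"
    define f where "f = sqmom l 0 x"
    define V where "V = 1 - x\<^sup>2"
    define k' where "k' = 2 * L * k / x - 2 * L - k\<^sup>2 / V"
    have V0: "V > 0" using v by (simp add: V_def)
    have dK: "(ln_slope l has_real_derivative k') (at x)"
      using DERIV_ln_slope[OF x0 x(2), of l] by (simp add: k'_def k_def L_def V_def)
    have df: "(sqmom l 0 has_real_derivative f * k / V) (at x)"
      using DERIV_sqmom_0[OF x0 x(2), of l] by (simp add: f_def k_def V_def)
    have dJ: "(ln_curv l has_real_derivative - 4 * L * k + 2 * L * V * k' / x - 2 * L * V * k / x\<^sup>2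
         + 2 * k + 2 * x * k' + 4 * L * x - 2 * k * k') (at x)"
      unfolding ln_curv_def[abs_def]
      by (rule derivative_eq_intros dK less_imp_neq[OF x0, symmetric] refl)+
         (use x0 in \<open>simp_all add: k_def L_def V_def field_simps power2_eq_square\<close>)
    \<comment> \<open>\<open>- B / x\<close> is what remains of the derivative, up to the weight,
      once the contributions of the integrating factor are combined with the derivative of
      \<open>ln_curv\<close>.\<close>
    define B where "B = k * (2 * L / x + (2 * L - 2) * x) - 2 * x\<^sup>2 * k\<^sup>2 / V"
    have alg: "- 2 * L * ln_curv l x / x + 2 * k * ln_curv l x / V + (- 4 * L * k + 2 * L * V * k' / x - 2 * L * V * k / x\<^sup>2
         + 2 * k + 2 * x * k' + 4 * L * x - 2 * k * k') = - B / x"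
    proof -
      have J: "ln_curv l x = 2 * L * V * k / x + 2 * x * k - 2 * L * V - k\<^sup>2"
        by (simp add: ln_curv_def L_def V_def k_def)
      have V: "x * x = 1 - V" by (simp add: V_def power2_eq_square)
      show ?thesis unfolding J k'_def B_def using x0 V0
        by (simp add: divide_simps) (use V in algebra)
    qed
    have "(?M has_real_derivative f\<^sup>2 / x ^ (2 * l) * (- 2 * L * ln_curv l x / x + 2 * k * ln_curv l x / V + (- 4 * L * k + 2 * L * V * k' / x - 2 * L * V * k / x\<^sup>2
         + 2 * k + 2 * x * k' + 4 * L * x - 2 * k * k'))) (at x)"
      by (rule back_subst[where P = "\<lambda>D. (_ has_real_derivative D) _", OF DERIV_divide_power[OF DERIV_mult[OF DERIV_power[OF df, of 2] dJ] x0]])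
         (simp add: f_def[symmetric] L_def[symmetric] field_simps power2_eq_square)
    moreover have "f\<^sup>2 / x ^ (2 * l) * (- B / x) \<le> 0"
    proof -
      have k0: "0 \<le> k" using ln_slope_nonneg[OF x0 x(2)] by (simp add: k_def)
      have "x * k \<le> L * V" using ln_slope_le[OF x0 x(2)] by (simp add: k_def L_def V_def)
      then have "2 * x * (x * k) \<le> 2 * x * (L * V)" using x0 by simp
      then have "2 * x\<^sup>2 * k / V \<le> 2 * x * L" using V0 by (simp add: field_simps power2_eq_square)
      \<comment> \<open>The inequality amounts to \<open>x^2 \<le> L\<close>, which follows from
        \<open>x \<le> 1 \<le> L\<close>.\<close>
      also have "\<dots> \<le> 2 * L / x + (2 * L - 2) * x"
      proof -
        have "L \<ge> 1" using assms by (simp add: L_def)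
        have "x * x \<le> 1" using x x0 by (simp add: mult_le_one)
        then have "1 * (x * x) \<le> L * 1" using \<open>L \<ge> 1\<close> by (intro mult_mono) auto
        then have "x \<le> L / x" using x0 by (simp add: field_simps)
        then show ?thesis by (simp add: left_diff_distrib)
      qed
      finally have "0 \<le> k * ((2 * L / x + (2 * L - 2) * x) - 2 * x\<^sup>2 * k / V)" using k0 by simp
      also have "\<dots> = B" by (simp add: B_def algebra_simps power2_eq_square)
      finally show ?thesis using x0 by (simp add: mult_nonneg_nonneg)
    qed
    ultimately show "\<exists>y. (?M has_real_derivative y) (at x) \<and> y \<le> 0" unfolding alg by blast
  qed (use assms in auto)
  then show ?thesis
    using assms sqmom_0_pos[of w l] zero_less_power[of w "2 * l"]
    by (auto simp: ln_curv_def[of l 1] zero_le_divide_iff zero_le_mult_iff not_le[symmetric] simp del: zero_less_power)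
qed

section \<open>Comparison with the closed-form bound\<close>

text \<open>This is the theorem with \<open>c\<close> scaled out: \<open>r = - \<rho> / c\<close>
  and \<open>1 - w^2 = - 4 * c * T\<close>. The function \<open>H\<close>, the logarithm of the
  left-hand side over the right-hand side, is nondecreasing and vanishes at 1.\<close>

lemma sqmom_0_square_le:
  fixes l :: nat and r R :: real
  assumes l: "l \<ge> 1" and w: "0 \<le> w" "w \<le> 1"
    and r: "r = sqrt ((real l)\<^sup>2 + 1)" and R: "R = sqrt (w ^ 4 + (real l)\<^sup>2 * (1 - w\<^sup>2)\<^sup>2)"
  shows "0 < R" "0 < r * R + r\<^sup>2 * (1 - w\<^sup>2) - 1" "1 < r"
    "(sqmom l 0 w)\<^sup>2 \<le> 2 / (w\<^sup>2 + R) * (1 / (R + real l * (1 - w\<^sup>2))) powr (- real l)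
       * ((r * R + r\<^sup>2 * (1 - w\<^sup>2) - 1) / (r - 1)) powr (- r)"
proof -
  define L where "L = real l"
  have L1: "L \<ge> 1" using l by (simp add: L_def)
  have r2: "r\<^sup>2 = L\<^sup>2 + 1" by (simp add: r L_def add_nonneg_nonneg)
  show r1: "1 < r" using L1 by (simp add: r L_def)
  define Q where "Q x = sqrt (x ^ 4 + L\<^sup>2 * (1 - x\<^sup>2)\<^sup>2)" for x
  have RQ: "R = Q w" by (simp add: R Q_def L_def)
  have Qarg: "x ^ 4 + L\<^sup>2 * (1 - x\<^sup>2)\<^sup>2 > 0" for x
  proof (cases "x = 0")
    case False
    then have "x ^ 4 > 0" by simp
    then show ?thesis by (simp add: add_pos_nonneg)
  qed (use L1 in simp)
  have Q0: "Q x > 0" for x using Qarg by (simp add: Q_def)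
  have Q2: "(Q x)\<^sup>2 = x ^ 4 + L\<^sup>2 * (1 - x\<^sup>2)\<^sup>2" for x
    using Qarg[of x] by (simp add: Q_def)
  have X0: "0 < r * Q x + r\<^sup>2 * (1 - x\<^sup>2) - 1" for x
  proof -
    \<comment> \<open>Brahmagupta's identity for the product of \<open>1 + L^2\<close> and
      \<open>(x^2)^2 + (L * (1 - x^2))^2\<close>.\<close>
    have "(r * Q x)\<^sup>2 = (1 - r\<^sup>2 * (1 - x\<^sup>2))\<^sup>2 + L\<^sup>2"
      unfolding power_mult_distrib Q2 r2 by algebra
    moreover have "0 < L\<^sup>2" using L1 by simp
    ultimately have "(1 - r\<^sup>2 * (1 - x\<^sup>2))\<^sup>2 < (r * Q x)\<^sup>2" by linarith
    then have "1 - r\<^sup>2 * (1 - x\<^sup>2) < r * Q x"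
      by (rule power2_less_imp_less) (use Q0[of x] r1 in simp)
    then show ?thesis by simp
  qed
  show "0 < R" "0 < r * R + r\<^sup>2 * (1 - w\<^sup>2) - 1" using Q0 X0 by (simp_all add: RQ)
  define H where "H x = 2 * ln (sqmom l 0 x) - (ln 2 - ln (x\<^sup>2 + Q x) + L * ln (Q x + L * (1 - x\<^sup>2))
     - r * ln ((r * Q x + r\<^sup>2 * (1 - x\<^sup>2) - 1) / (r - 1)))" for x
  have pos1: "0 < x\<^sup>2 + Q x" for x using Q0[of x] by (simp add: add_nonneg_pos)
  have pos2: "0 < Q x + L * (1 - x\<^sup>2)" if "0 \<le> x" "x \<le> 1" for x
    using Q0[of x] L1 that by (simp add: add_pos_nonneg power_le_one)
  have contQ: "continuous_on {w..1} Q"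
    unfolding Q_def[abs_def] by (intro continuous_intros)
  \<comment> \<open>The derivative is taken only on the open interval, so \<open>w = 0\<close>,
    where the differential equation is singular, is covered by continuity.\<close>
  have "H w \<le> H 1"
  proof (rule DERIV_nonneg_imp_increasing_open[where f = H])
    show "continuous_on {w..1} H"
      unfolding H_def[abs_def]
      by (intro continuous_intros contQ ballI less_imp_neq[symmetric] pos1 pos2 sqmom_0_pos divide_pos_pos X0)
         (use w r1 in auto)
    fix x assume "w < x" and x1: "x < 1"
    then have x0: "0 < x" using w by simp
    define V where "V = 1 - x\<^sup>2"
    have V0: "V > 0" using x0 x1 by (simp add: V_def abs_square_less_1)
    define q where "q = Q x"
    have q0: "q > 0" and q2: "q\<^sup>2 = x ^ 4 + L\<^sup>2 * V\<^sup>2"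
      using Q0 Q2 by (simp_all add: q_def V_def)
    define q' where "q' = - 2 * x * (r\<^sup>2 * V - 1) / q"
    have dQ: "(Q has_real_derivative q') (at x)"
    proof -
      have "((\<lambda>x. x ^ 4 + L\<^sup>2 * (1 - x\<^sup>2)\<^sup>2) has_real_derivative
          4 * x ^ 3 + L\<^sup>2 * (2 * V * (- (2 * x)))) (at x)"
        unfolding V_def by (rule derivative_eq_intros refl)+ simp
      from DERIV_chain2[OF DERIV_real_sqrt[OF Qarg] this]
      have "(Q has_real_derivative (4 * x ^ 3 + L\<^sup>2 * (2 * V * (- (2 * x)))) / (2 * q)) (at x)"
        unfolding q_def Q_def[abs_def] by (simp only: divide_inverse inverse_mult_distrib mult_ac)
      also have "(4 * x ^ 3 + L\<^sup>2 * (2 * V * (- (2 * x)))) / (2 * q) = (2 * x ^ 3 - 2 * L\<^sup>2 * x * V) / q"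
        using q0 by (simp add: divide_simps)
      also have "\<dots> = q'" unfolding q'_def r2 V_def
        by (rule arg_cong[where f = "\<lambda>y. y / q"]) algebra
      finally show ?thesis .
    qed
    \<comment> \<open>Modulo the relation \<open>q2\<close>, the logarithmic derivatives of the
      three factors of the bound collapse to the simple fractions in \<open>e1\<close>,
      \<open>e2\<close> and \<open>e3\<close>.\<close>
    have e1: "(2 * x + q') / (x\<^sup>2 + q) = - 2 * x * (q - 1) / (V * q)"
    proof -
      have "(2 * x * q - 2 * x * (r\<^sup>2 * V - 1)) * V = - 2 * x * (q - 1) * (x\<^sup>2 + q)"
        using q2 unfolding V_def r2 by algebra
      then show ?thesis using V0 q0 pos1[of x]
        by (simp add: q'_def q_def[symmetric] divide_simps)
    qed
    have e2: "(q' - 2 * L * x) / (q + L * V) = - 2 * (L - q) / (q * x)"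
    proof -
      have "(- 2 * x * (r\<^sup>2 * V - 1) - 2 * L * x * q) * x = - 2 * (L - q) * (q + L * V)"
        using q2 unfolding V_def r2 by algebra
      then show ?thesis using x0 q0 pos2[of x] x1
        by (simp add: q'_def q_def[symmetric] V_def[symmetric] divide_simps)
    qed
    have e3: "(r * q' - 2 * r\<^sup>2 * x) / (r * q + r\<^sup>2 * V - 1) = - 2 * x * r / q"
      using q0 X0[of x]
      by (simp add: q'_def q_def[symmetric] V_def[symmetric] divide_simps) algebra
    have d1: "((\<lambda>x. ln (x\<^sup>2 + Q x)) has_real_derivative - 2 * x * (q - 1) / (V * q)) (at x)"
      unfolding e1[symmetric]
      by (rule derivative_eq_intros dQ pos1 refl)+ (simp add: q_def)
    have d2: "((\<lambda>x. ln (Q x + L * (1 - x\<^sup>2))) has_real_derivative - 2 * (L - q) / (q * x)) (at x)"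
      unfolding e2[symmetric]
      by (rule derivative_eq_intros dQ pos2[OF less_imp_le[OF x0] less_imp_le[OF x1]] refl)+
         (simp add: q_def V_def field_simps)
    have d3: "((\<lambda>x. ln ((r * Q x + r\<^sup>2 * (1 - x\<^sup>2) - 1) / (r - 1))) has_real_derivative - 2 * x * r / q) (at x)"
    proof -
      have ln_eq: "ln ((r * Q x + r\<^sup>2 * (1 - x\<^sup>2) - 1) / (r - 1)) = ln (r * Q x + r\<^sup>2 * (1 - x\<^sup>2) - 1) - ln (r - 1)" for x
        using X0[of x] r1 by (simp add: ln_div)
      show ?thesis unfolding ln_eq e3[symmetric]
        by (rule derivative_eq_intros dQ X0 refl)+ (simp add: q_def V_def field_simps)
    qed
    have d0: "((\<lambda>x. ln (sqmom l 0 x)) has_real_derivative ln_slope l x / V) (at x)"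
    proof -
      have f: "0 < sqmom l 0 x" using sqmom_0_pos x0 x1 by simp
      show ?thesis
        using DERIV_chain2[OF DERIV_ln_divide[OF f] DERIV_sqmom_0[OF x0 x1]] f by (simp add: V_def)
    qed
    \<comment> \<open>With \<open>y = x * ln_slope l x\<close>, the curvature satisfies
      \<open>x^2 * ln_curv l x = 2 * a * y - 2 * L * x^2 * V - y^2\<close>. Since
      \<open>a^2 - 2 * L * x^2 * V = q^2\<close>, its roots in \<open>y\<close> are
      \<open>a - q\<close> and \<open>a + q\<close>; log-convexity places \<open>y\<close> between
      them, and \<open>y \<ge> a - q\<close> is the monotonicity of \<open>H\<close>.\<close>
    define a where "a = L * V + x\<^sup>2"
    have "(H has_real_derivative 2 * (ln_slope l x / V) - (0 - (- 2 * x * (q - 1) / (V * q)) + L * (- 2 * (L - q) / (q * x)) - r * (- 2 * x * r / q))) (at x)"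
      unfolding H_def[abs_def]
      by (rule DERIV_diff DERIV_add DERIV_cmult DERIV_const d0 d1 d2 d3)+
    also have "2 * (ln_slope l x / V) - (0 - (- 2 * x * (q - 1) / (V * q)) + L * (- 2 * (L - q) / (q * x)) - r * (- 2 * x * r / q))
        = 2 * (x * ln_slope l x - (a - q)) / (x * V)"
    proof -
      have "x\<^sup>2 * (q - 1) - L * (L - q) * V + r\<^sup>2 * x\<^sup>2 * V = q * (a - q)"
        using q2 unfolding a_def r2 V_def by algebra
      then show ?thesis using x0 V0 q0
        by (simp add: divide_simps) algebra
    qed
    finally have dH: "(H has_real_derivative 2 * (x * ln_slope l x - (a - q)) / (x * V)) (at x)" .
    have "(a - x * ln_slope l x)\<^sup>2 \<le> q\<^sup>2"
    proof -
      have "x\<^sup>2 * ln_curv l x \<ge> 0" using ln_curv_nonneg[OF x0 x1 l] by simp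
      also have "x\<^sup>2 * ln_curv l x = 2 * a * (x * ln_slope l x) - 2 * L * x\<^sup>2 * V - (x * ln_slope l x)\<^sup>2"
        using x0 by (simp add: ln_curv_def a_def L_def V_def power2_eq_square field_simps)
      finally show ?thesis unfolding q2 by (simp add: a_def V_def power2_eq_square power4_eq_xxxx algebra_simps)
    qed
    then have "a - x * ln_slope l x \<le> q"
      using q0 power2_le_imp_le by fastforce
    then have "0 \<le> 2 * (x * ln_slope l x - (a - q)) / (x * V)" using x0 V0 by simp
    with dH show "\<exists>y. (H has_real_derivative y) (at x) \<and> 0 \<le> y" by blast
  qed (use w in auto)
  also have "H 1 = 0" using r1 by (simp add: H_def Q_def)
  finally have Hw: "H w \<le> 0" .
  let ?Y = "(r * R + r\<^sup>2 * (1 - w\<^sup>2) - 1) / (r - 1)"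
  have f0: "0 < sqmom l 0 w" using w sqmom_0_pos by simp
  have Y0: "0 < ?Y" using X0[of w] r1 by (simp add: RQ)
  have R1: "0 < w\<^sup>2 + R" "0 < R + L * (1 - w\<^sup>2)" using pos1 pos2 w by (simp_all add: RQ)
  have "(sqmom l 0 w)\<^sup>2 = exp (2 * ln (sqmom l 0 w))"
    using f0 by (simp add: exp_double)
  also have "\<dots> \<le> exp (ln 2 - ln (w\<^sup>2 + R) + L * ln (R + L * (1 - w\<^sup>2)) - r * ln ?Y)"
    using Hw by (simp add: H_def RQ)
  also have "\<dots> = 2 / (w\<^sup>2 + R) * (1 / (R + L * (1 - w\<^sup>2))) powr (- L) * ?Y powr (- r)"
  proof -
    have "exp (ln 2 - ln a + L * ln b - r * ln y) = 2 / a * (1 / b) powr (- L) * y powr (- r)"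
      if "0 < a" "0 < b" "0 < y" for a b y :: real
      using that by (simp add: exp_add exp_diff powr_def exp_minus ln_div ln_inverse divide_inverse)
    then show ?thesis using Y0 R1 by blast
  qed
  finally show "(sqmom l 0 w)\<^sup>2 \<le> 2 / (w\<^sup>2 + R) * (1 / (R + real l * (1 - w\<^sup>2))) powr (- real l)
       * ?Y powr (- r)" by (simp add: L_def)
qed

section \<open>Return to the original variables\<close>

theorem theorem4p1:
  fixes c n t T \<rho> R :: real and l :: nat
  assumes "c < 0" and "l \<ge> 1" and "n = - c * real l"
    and "t \<in> {0..- 1 / c}"
    and "T = t + c * t\<^sup>2"
    and "\<rho> = sqrt (n\<^sup>2 + c\<^sup>2)"
    and "R = sqrt (16 * \<rho>\<^sup>2 * T\<^sup>2 + 8 * c * T + 1)"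
  shows "(S n c t)\<^sup>2 \<le> 2 / (1 + 4 * c * T + R) * (1 / (R + 4 * n * T)) powr (n / c)
           * ((\<rho> * R + 4 * \<rho>\<^sup>2 * T + c) / (\<rho> + c)) powr (\<rho> / c)"
proof -
  define w where "w = \<bar>1 + 2 * c * t\<bar>"
  define r where "r = sqrt ((real l)\<^sup>2 + 1)"
  have "-1 \<le> c * t" "c * t \<le> 0"
    using assms(1,4) by (auto simp: field_simps mult_nonpos_nonneg)
  then have w: "0 \<le> w" "w \<le> 1" by (auto simp: w_def)
  have w2: "w\<^sup>2 = 1 + 4 * c * T"
    by (simp add: w_def assms(5) power2_eq_square algebra_simps)
  have S: "S n c t = sqmom l 0 w"
  proof -
    have "S n c t = sqmom l 0 (1 + 2 * c * t)"
    proof -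
      have "(1 - (1 + 2 * c * t)) / 2 = - c * t" "(1 + (1 + 2 * c * t)) / 2 = 1 + c * t" by simp_all
      then show ?thesis
        unfolding S_eq[OF assms(1,3,4)] sqmom_def by (simp only: , simp add: power_mult_distrib power_even_eq)
    qed
    then show ?thesis using sqmom_0_uminus[of l "1 + 2 * c * t"] by (auto simp: w_def abs_if)
  qed
  have \<rho>: "\<rho> = - c * r"
  proof -
    have "n\<^sup>2 + c\<^sup>2 = c\<^sup>2 * ((real l)\<^sup>2 + 1)" by (simp add: assms(3) power_mult_distrib algebra_simps)
    then show ?thesis using assms(1) by (simp add: assms(6) r_def real_sqrt_mult)
  qed
  have r2: "r\<^sup>2 = (real l)\<^sup>2 + 1" by (simp add: r_def add_nonneg_nonneg)
  \<comment> \<open>The radicand is \<open>(1 + 4 * c * T)^2 + l^2 * (4 * c * T)^2\<close>, because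
    \<open>\<rho>^2 = c^2 * (l^2 + 1)\<close>.\<close>
  have R: "R = sqrt (w ^ 4 + (real l)\<^sup>2 * (1 - w\<^sup>2)\<^sup>2)"
  proof -
    have "w ^ 4 = (w\<^sup>2)\<^sup>2" by simp
    then show ?thesis unfolding assms(7) w2 \<rho> power_mult_distrib r2
      by (simp add: power2_eq_square algebra_simps)
  qed
  note main = sqmom_0_square_le[OF assms(2) w r_def R]
  have "(\<rho> * R + 4 * \<rho>\<^sup>2 * T + c) / (\<rho> + c) = (- c * (r * R + r\<^sup>2 * (1 - w\<^sup>2) - 1)) / (- c * (r - 1))"
    unfolding w2 \<rho> by (simp add: power2_eq_square algebra_simps)
  also have "\<dots> = (r * R + r\<^sup>2 * (1 - w\<^sup>2) - 1) / (r - 1)"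
    using assms(1) by (intro mult_divide_mult_cancel_left) simp
  finally have Y: "(\<rho> * R + 4 * \<rho>\<^sup>2 * T + c) / (\<rho> + c) = (r * R + r\<^sup>2 * (1 - w\<^sup>2) - 1) / (r - 1)" .
  have "n / c = - real l" "\<rho> / c = - r" "R + 4 * n * T = R + real l * (1 - w\<^sup>2)"
    using assms(1) unfolding w2 by (simp_all add: assms(3) \<rho>)
  with main(4) show ?thesis
    unfolding S Y w2[symmetric] by simp
qed

end
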